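(* Let $X_1, X_2, X_3$ be independent identically distributed random variables having a symmetric distribution. Suppose that $\varepsilon$ is a Bernoulli random variable taking the values $1$ and $0$ with equal probabilities, and that $\varepsilon$ is independent of $X_1, X_2, X_3$. The relation $$X_1 \stackrel{d}{=} \frac{X_1+X_2}{2} + \varepsilon X_3$$ holds if and only if $X_1$ has a hyperbolic secant distribution.
   Context: The symbol $\stackrel{d}{=}$ denotes equality in distribution. The distribution of a real random variable $X$ is symmetric if $X \stackrel{d}{=} -X$. The standard hyperbolic secant distribution is the distribution on the real line with density $p(x) = \frac{1}{\pi}\cdot\frac{1}{\cosh(x)}$; its characteristic function is $f(t) = \frac{1}{\cosh(\pi t/2)}$. The term "hyperbolic secant distribution" is used for the general case with a scale parameter: $X$ has a hyperbolic secant distribution if for some $a>0$ its density is $\frac{1}{\pi a \cosh(x/a)}$, equivalently its characteristic function is $\frac{1}{\cosh(\pi a t/2)}$.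
   Formalization: The formal theorem additionally assumes that X_1 is not almost surely 0: if X_1 = X_2 = X_3 = 0, the distribution is symmetric and the relation holds, but X_1 has no hyperbolic secant distribution. *)

theory Defs
  imports "HOL-Probability.Probability"
begin

definition eq_in_dist :: "'a measure \<Rightarrow> ('a \<Rightarrow> real) \<Rightarrow> ('a \<Rightarrow> real) \<Rightarrow> bool" where
  "eq_in_dist M X Y \<longleftrightarrow> distr M borel X = distr M borel Y"

definition symmetric_dist :: "'a measure \<Rightarrow> ('a \<Rightarrow> real) \<Rightarrow> bool" where
  "symmetric_dist M X \<longleftrightarrow> eq_in_dist M X (\<lambda>\<omega>. - X \<omega>)"

definition hyperbolic_secant_density :: "real \<Rightarrow> real \<Rightarrow> real" where
  "hyperbolic_secant_density a x = 1 / (pi * a * cosh (x / a))"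

definition hyperbolic_secant_dist :: "'a measure \<Rightarrow> ('a \<Rightarrow> real) \<Rightarrow> bool" where
  "hyperbolic_secant_dist M X \<longleftrightarrow>
     (\<exists>a>0. distributed M lborel X (\<lambda>x. ennreal (hyperbolic_secant_density a x)))"

text \<open>A fair Bernoulli variable, realised as a real random variable with values 0 and 1.\<close>

definition fair_bernoulli :: "'a measure \<Rightarrow> ('a \<Rightarrow> real) \<Rightarrow> bool" where
  "fair_bernoulli M \<epsilon> \<longleftrightarrow>
     distr M borel \<epsilon> = distr (measure_pmf (bernoulli_pmf (1/2))) borel (of_bool :: bool \<Rightarrow> real)"

text \<open>
  The library's \<open>indep_var\<close> requires both variables to take values in the same type; this is
  the same notion for two different value types.
\<close>

definition indep_rv ::
  "'a measure \<Rightarrow> 'b measure \<Rightarrow> ('a \<Rightarrow> 'b) \<Rightarrow> 'c measure \<Rightarrow> ('a \<Rightarrow> 'c) \<Rightarrow> bool" where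
  "indep_rv M N Y K Z \<longleftrightarrow>
     Y \<in> measurable M N \<and> Z \<in> measurable M K \<and>
     prob_space.indep_set M {Y -` A \<inter> space M |A. A \<in> sets N}
                            {Z -` B \<inter> space M |B. B \<in> sets K}"

end

theory Submission
  imports Defs "HOL-Complex_Analysis.Complex_Analysis" "HOL-Real_Asymp.Real_Asymp"
begin

text \<open>
  Let \<open>f\<close> be the characteristic function of \<open>X\<^sub>1\<close>; it is real because the law is symmetric.
  Conditioning on \<open>\<epsilon>\<close> and using independence, the equality in distribution says exactly that
  \<open>f(t) = f(t/2)\<^sup>2 (1 + f(t)) / 2\<close> for all \<open>t\<close>
  (\<open>char_half_sum_plus_bernoulli_multiple\<close> together with the uniqueness theorem for
  characteristic functions).  For \<open>f(t) = 1/cosh(\<sigma>t)\<close> this is the duplication formula of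
  \<open>cosh\<close>, so the sech laws satisfy the relation.

  For the converse, the equation keeps \<open>f\<close> positive, so that \<open>f = 1/cosh h\<close> with \<open>h \<ge> 0\<close>, and it
  turns into \<open>h(t) = 2 h(t/2)\<close>.  This alone leaves freedom, since \<open>h(t)/\<bar>t\<bar>\<close> may be any nonnegative even function
  invariant under \<open>t \<mapsto> 2t\<close>.  What removes it is the behaviour of a characteristic function
  at the origin.  Along the points \<open>t/2\<^sup>n\<close> the quotients
  \<open>4\<^sup>n (1 - f(t/2\<^sup>n)) = E[4\<^sup>n (1 - cos(t X\<^sub>1/2\<^sup>n))]\<close> tend to \<open>h(t)\<^sup>2/2\<close>.  For \<open>t = 1\<close>, Fatou's lemma shows
  that \<open>X\<^sub>1\<close> has a finite second moment \<open>m\<close>; then dominated convergence evaluates the same limit as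
  \<open>t\<^sup>2 m/2\<close> for every \<open>t\<close>.  Hence \<open>h(t) = \<surd>m \<bar>t\<bar>\<close> (\<open>halving_equation_imp_sech\<close>).

  It remains to know that \<open>1/cosh(\<pi>at/2)\<close> is the characteristic function of the hyperbolic secant
  law of scale \<open>a\<close>.  This is a residue computation (\<open>fourier_sech\<close>): the function
  \<open>exp(itz)/cosh z\<close> is multiplied by \<open>-exp(-\<pi>t)\<close> under the shift \<open>z \<mapsto> z + i\<pi>\<close>, so integrating it
  around a rectangle of height \<open>\<pi>\<close> determines its integral over the real line from the single
  residue at \<open>i\<pi>/2\<close>.
\<close>

section \<open>The Fourier transform of the hyperbolic secant\<close>

text \<open>
  Of the two exponentials in \<open>cosh z\<close> one dominates as soon as \<open>Re z \<noteq> 0\<close>.  The bound serves twice: it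
  puts all zeros of \<open>cosh\<close> on the imaginary axis, and it makes the vertical sides of the contour
  negligible.
\<close>

lemma cmod_cosh_ge:
  fixes z :: complex
  shows "sinh \<bar>Re z\<bar> \<le> cmod (cosh z)"
proof -
  have "\<bar>exp (Re z) - exp (- Re z)\<bar> \<le> cmod (exp z + exp (- z))"
    using norm_triangle_ineq3[of "exp z" "- exp (- z)"] by simp
  moreover have "\<bar>exp (Re z) - exp (- Re z)\<bar> = 2 * sinh \<bar>Re z\<bar>"
    by (cases "Re z \<ge> 0") (simp_all add: sinh_field_def)
  ultimately show ?thesis
    by (simp add: cosh_field_def norm_divide)
qed

lemma cosh_sinh_imaginary:
  fixes y :: real
  shows "cosh (\<i> * of_real y) = (of_real (cos y) :: complex)"
    and "sinh (\<i> * of_real y) = \<i> * (of_real (sin y) :: complex)"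
  by (simp_all add: complex_eq_iff cosh_field_def sinh_field_def Re_exp Im_exp)

text \<open>
  An open convex neighbourhood of the closed strip \<open>0 \<le> Im z \<le> \<pi>\<close> which is small enough to contain
  only one zero of \<open>cosh\<close>; the next ones, \<open>-i\<pi>/2\<close> and \<open>3i\<pi>/2\<close>, lie on its boundary.
\<close>

definition strip :: "complex set" where
  "strip = {z. - (pi / 2) < Im z \<and> Im z < 3 * pi / 2}"

lemma cosh_eq_0_strip:
  assumes "z \<in> strip" "cosh z = 0"
  shows "z = \<i> * (pi / 2)"
proof -
  have "sinh \<bar>Re z\<bar> \<le> 0" using cmod_cosh_ge[of z] assms by simp
  then have "Re z = 0" by simp
  then have z: "z = \<i> * of_real (Im z)" by (simp add: complex_eq_iff)
  have "complex_of_real (cos (Im z)) = cosh z"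
    using cosh_sinh_imaginary(1)[of "Im z"] z by metis
  then have "cos (Im z) = 0" using assms(2) by simp
  then have "sin (Im z - pi / 2) = 0" by (simp add: sin_diff)
  moreover have "- pi < Im z - pi / 2" "Im z - pi / 2 < pi"
    using assms(1) by (simp_all add: strip_def)
  ultimately have "Im z = pi / 2" using sin_eq_0_pi[of "Im z - pi / 2"] by simp
  with z show ?thesis by metis
qed

text \<open>
  An antiderivative of \<open>1/cosh\<close> is \<open>arctan \<circ> sinh\<close>, which is bounded.
\<close>

lemma integrable_sech: "integrable lborel (\<lambda>x::real. 1 / cosh x)"
proof -
  have "set_integrable lborel (einterval (-\<infinity>) \<infinity>) (\<lambda>x::real. 1 / cosh x)"
  proof (rule interval_integral_FTC_nonneg[where F = "\<lambda>x. arctan (sinh x)" and A = "- (pi / 2)" and B = "pi / 2"])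
    show "DERIV (\<lambda>x. arctan (sinh x)) x :> 1 / cosh x" for x :: real
    proof -
      have "1 + (sinh x)\<^sup>2 = (cosh x)\<^sup>2" by (simp add: cosh_square_eq)
      then have "inverse (1 + (sinh x)\<^sup>2) * cosh x = 1 / cosh x"
        by (simp add: power2_eq_square field_simps)
      then show ?thesis by (auto intro!: derivative_eq_intros)
    qed
    show "(((\<lambda>x. arctan (sinh x)) \<circ> real_of_ereal) \<longlongrightarrow> pi / 2) (at_left \<infinity>)"
      using filterlim_compose[OF tendsto_arctan_at_top sinh_real_at_top]
      by (simp add: ereal_tendsto_simps1)
    show "(((\<lambda>x. arctan (sinh x)) \<circ> real_of_ereal) \<longlongrightarrow> - (pi / 2)) (at_right (-\<infinity>))"
      using filterlim_compose[OF tendsto_arctan_at_bot sinh_real_at_bot]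
      by (simp add: ereal_tendsto_simps1)
    show "isCont (\<lambda>x. 1 / cosh x) x" for x :: real
      by (intro continuous_intros) simp_all
  qed simp_all
  then show ?thesis by (simp add: set_integrable_def)
qed

lemma integrable_fourier_sech: "integrable lborel (\<lambda>x. iexp (t * x) / complex_of_real (cosh x))"
  by (rule Bochner_Integration.integrable_bound[OF integrable_sech])
    (auto simp: norm_divide intro!: borel_measurable_continuous_onI continuous_intros)

lemma DERIV_cosh: "(cosh has_field_derivative sinh z) (at z)" for z :: complex
  using has_field_derivative_cosh[OF DERIV_ident, of z UNIV] by simp

lemma holomorphic_cosh: "cosh holomorphic_on A" for A :: "complex set"
  unfolding holomorphic_on_def field_differentiable_def
  using DERIV_cosh has_field_derivative_at_within by blast

text \<open>
  The only pole inside the rectangle is the simple zero \<open>p = i\<pi>/2\<close> of \<open>cosh\<close>, where the derivative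
  \<open>sinh p\<close> is \<open>i\<close>; the residue is therefore \<open>exp(-\<pi>t/2)/i\<close>.
\<close>

lemma contour_integral_sech_rect:
  fixes t R :: real
  assumes "R > 0"
  defines "F \<equiv> \<lambda>z. exp (\<i> * t * z) / cosh z"
  shows "contour_integral (rectpath (Complex (-R) 0) (Complex R pi)) F = 2 * pi * exp (- (pi * t / 2))"
proof -
  let ?g = "rectpath (Complex (-R) 0) (Complex R pi)"
  define p where "p = \<i> * complex_of_real (pi / 2)"
  have strip: "convex strip" "open strip"
  proof -
    have eq: "strip = {z. - (pi / 2) < Im z} \<inter> {z. Im z < 3 * pi / 2}" by (auto simp: strip_def)
    show "convex strip" unfolding eq by (intro convex_Int convex_halfspace_Im_gt convex_halfspace_Im_lt)
    show "open strip" unfolding eq by (intro open_Int open_halfspace_Im_gt open_halfspace_Im_lt)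
  qed
  have conn: "connected strip" using strip(1) by (rule convex_connected)
  have p: "p \<in> strip" by (simp add: strip_def p_def)
  have image: "path_image ?g \<subseteq> strip - {p}"
  proof
    have p: "Re p = 0" "Im p = pi / 2" by (simp_all add: p_def)
    fix z assume "z \<in> path_image ?g"
    then have "(Re z = - R \<or> Re z = R) \<and> 0 \<le> Im z \<and> Im z \<le> pi \<or> (Im z = 0 \<or> Im z = pi)"
      using assms(1) by (subst (asm) path_image_rectpath) (simp_all, blast)
    with assms(1) p have z: "0 \<le> Im z" "Im z \<le> pi" "z \<noteq> p"
      using pi_gt_zero by force+
    have "- (pi / 2) < Im z" "Im z < 3 * pi / 2" using z pi_gt_zero by linarith+
    with z show "z \<in> strip - {p}" unfolding strip_def by blast
  qed
  have cosh_p: "cosh p = 0" and sinh_p: "sinh p = \<i>"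
    unfolding p_def cosh_sinh_imaginary by simp_all
  have int: "contour_integral ?g F = 2 * pi * \<i> * (\<Sum>p\<in>{p}. winding_number ?g p * residue F p)"
  proof (rule Residue_theorem[of strip])
    have "cosh z \<noteq> 0" if "z \<in> strip - {p}" for z
      using cosh_eq_0_strip[of z] that by (auto simp: p_def)
    then show "F holomorphic_on strip - {p}"
      unfolding F_def by (intro holomorphic_intros holomorphic_cosh)
    show "\<forall>z. z \<notin> strip \<longrightarrow> winding_number ?g z = 0"
    proof (intro allI impI)
      fix z assume "z \<notin> strip"
      with image strip(1) show "winding_number ?g z = 0"
        by (intro winding_number_zero_outside[of ?g strip] path_rectpath) auto
    qed
  qed (use image strip(2) conn in \<open>simp_all only: valid_path_rectpath pathstart_rectpath pathfinish_rectpath finite.intros\<close>)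
  have wind: "winding_number ?g p = 1"
    using assms(1) by (intro winding_number_rectpath) (simp add: in_box_complex_iff p_def)
  have res: "residue F p = exp (\<i> * t * p) / sinh p"
    unfolding F_def
  proof (rule residue_simple_pole_deriv[of _ strip])
    show "(cosh has_field_derivative sinh p) (at p)" by (rule DERIV_cosh)
    show "(\<lambda>z. exp (\<i> * t * z)) holomorphic_on strip" by (intro holomorphic_intros)
    show "sinh p \<noteq> 0" "exp (\<i> * t * p) \<noteq> 0" using sinh_p by simp_all
  qed (fact strip(2) conn p cosh_p holomorphic_cosh)+
  have itp: "\<i> * t * p = of_real (- (pi * t / 2))"
    by (simp add: p_def complex_eq_iff)
  have expp: "exp (\<i> * t * p) = of_real (exp (- (pi * t / 2)))"
    unfolding itp by (rule exp_of_real)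
  have sum: "(\<Sum>p\<in>{p}. winding_number ?g p * residue F p) = of_real (exp (- (pi * t / 2))) / \<i>"
    by (simp add: wind res sinh_p expp)
  have cancel: "2 * of_real pi * \<i> * (x / \<i>) = 2 * of_real pi * x" for x :: complex
    by (simp add: complex_eq_iff)
  show ?thesis unfolding int sum by (simp only: of_real_mult of_real_numeral cancel)
qed

lemma integral_symmetric_intervals_tendsto:
  fixes f :: "real \<Rightarrow> 'b :: euclidean_space"
  assumes "integrable lborel f"
  shows "(\<lambda>n. integral {- real n..real n} f) \<longlonglongrightarrow> (\<integral>x. f x \<partial>lborel)"
proof -
  have [measurable]: "f \<in> borel_measurable lborel" using assms by auto
  have "set_integrable lborel {- real n..real n} f" for n
    using assms unfolding set_integrable_def by (intro integrable_mult_indicator) auto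
  then have eq: "integral {- real n..real n} f = (\<integral>x. indicator {- real n..real n} x *\<^sub>R f x \<partial>lborel)" for n
    by (simp flip: set_borel_integral_eq_integral(2) add: set_lebesgue_integral_def)
  show ?thesis
    unfolding eq
  proof (rule integral_dominated_convergence[where w = "\<lambda>x. norm (f x)"])
    show "AE x in lborel. (\<lambda>n. indicator {- real n..real n} x *\<^sub>R f x) \<longlonglongrightarrow> f x"
    proof (rule AE_I2)
      fix x :: real
      obtain N :: nat where "\<bar>x\<bar> \<le> real N" using real_arch_simple by blast
      then have "eventually (\<lambda>n. indicator {- real n..real n} x *\<^sub>R f x = f x) sequentially"
        by (auto simp: eventually_sequentially indicator_def intro!: exI[of _ N])
      then show "(\<lambda>n. indicator {- real n..real n} x *\<^sub>R f x) \<longlonglongrightarrow> f x"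
        by (rule tendsto_eventually)
    qed
  qed (use assms in \<open>auto split: split_indicator\<close>)
qed

lemma one_plus_exp_cosh: "1 + exp (- (2 * u)) = 2 * exp (- u) * cosh u" for u :: real
proof -
  have "exp (- u) * exp u = 1" "exp (- u) * exp (- u) = exp (- (2 * u))"
    by (simp_all flip: exp_add)
  then show ?thesis by (simp add: cosh_field_def distrib_left)
qed

text \<open>
  Write \<open>J(R)\<close> for the integral over \<open>[-R, R]\<close> and \<open>V(R)\<close> for the contribution of the two vertical
  sides.  The top side is the bottom side shifted by \<open>i\<pi>\<close> and traversed backwards, so it
  contributes \<open>exp(-\<pi>t) J(R)\<close>.  The residue computation thus reads
  \<open>(1 + exp(-\<pi>t)) J(R) + V(R) = 2\<pi> exp(-\<pi>t/2)\<close>, and \<open>V(R)\<close> vanishes as \<open>R \<rightarrow> \<infinity>\<close>.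
\<close>

lemma fourier_sech:
  "(\<integral>x. iexp (t * x) / complex_of_real (cosh x) \<partial>lborel) = of_real (pi / cosh (pi * t / 2))"
    (is "?I = _")
proof -
  define F where "F = (\<lambda>z. exp (\<i> * t * z) / cosh z)"
  define e where "e = complex_of_real (exp (- (pi * t)))"
  define V where "V = (\<lambda>R. contour_integral (linepath (Complex R 0) (Complex R pi)) F
    - contour_integral (linepath (Complex (-R) 0) (Complex (-R) pi)) F)"
  define J where "J = (\<lambda>R. integral {-R..R} (\<lambda>x. iexp (t * x) / complex_of_real (cosh x)))"
  \<comment> \<open>The bound is needed for both signs of \<open>R\<close>, that is, for the right and for the left side.\<close>
  have vert: "cmod (contour_integral (linepath (Complex R 0) (Complex R pi)) F) \<le> exp (\<bar>t\<bar> * pi) / sinh \<bar>R\<bar> * pi"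
    and cont_vert: "continuous_on (closed_segment (Complex R 0) (Complex R pi)) F" if "R \<noteq> 0" for R
  proof -
    let ?S = "closed_segment (Complex R 0) (Complex R pi)"
    have S: "Re z = R \<and> 0 \<le> Im z \<and> Im z \<le> pi" if "z \<in> ?S" for z
      using that by (simp add: closed_segment_same_Re closed_segment_eq_real_ivl)
    have ge: "sinh \<bar>R\<bar> \<le> cmod (cosh z)" if "z \<in> ?S" for z using cmod_cosh_ge[of z] S[OF that] by simp
    have pos: "sinh \<bar>R\<bar> > 0" using that by simp
    have ne: "cosh z \<noteq> 0" if "z \<in> ?S" for z using ge[OF that] pos by auto
    show cont: "continuous_on ?S F"
      unfolding F_def by (intro continuous_intros holomorphic_on_imp_continuous_on holomorphic_cosh ballI ne) 
    have "cmod (F z) \<le> exp (\<bar>t\<bar> * pi) / sinh \<bar>R\<bar>" if z: "z \<in> ?S" for z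
    proof -
      have "- (t * Im z) \<le> \<bar>t\<bar> * \<bar>Im z\<bar>" by (metis abs_ge_minus_self abs_mult)
      also have "\<dots> \<le> \<bar>t\<bar> * pi" using S[OF z] by (intro mult_left_mono) auto
      finally have "cmod (exp (\<i> * t * z)) \<le> exp (\<bar>t\<bar> * pi)" by simp
      then show ?thesis using ge[OF z] pos
        unfolding F_def norm_divide by (intro frac_le) auto
    qed
    from contour_integral_bound_linepath[OF contour_integrable_continuous_linepath[OF cont] _ this] pos
    show "cmod (contour_integral (linepath (Complex R 0) (Complex R pi)) F) \<le> exp (\<bar>t\<bar> * pi) / sinh \<bar>R\<bar> * pi"
      by (simp add: cmod_def)
  qed
  have rect: "J R * (1 + e) + V R = of_real (2 * pi * exp (- (pi * t / 2)))" if "R > 0" for R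
  proof -
    let ?a1 = "Complex (-R) 0" and ?a2 = "Complex R 0" and ?a3 = "Complex R pi" and ?a4 = "Complex (-R) pi"
    have shift: "F (z + \<i> * pi) = - e * F z" for z
    proof -
      have "\<i> * t * (z + \<i> * pi) = \<i> * t * z + of_real (- (pi * t))"
        by (simp add: complex_eq_iff algebra_simps)
      then have "exp (\<i> * t * (z + \<i> * pi)) = exp (\<i> * t * z) * e"
        unfolding e_def by (metis exp_add exp_of_real)
      then show ?thesis by (simp add: F_def cosh_add cosh_sinh_imaginary)
    qed
    have cosh_real: "cosh (complex_of_real x) = of_real (cosh x)" for x
      by (simp add: cosh_field_def exp_of_real flip: of_real_minus)
    have ne0: "cosh z \<noteq> 0" if z: "z \<in> closed_segment ?a1 ?a2" for z
    proof -
      have "z = of_real (Re z)" using z by (simp add: closed_segment_same_Im complex_eq_iff)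
      then show ?thesis using cosh_real[of "Re z"] by (metis cosh_real_nonzero of_real_eq_0_iff)
    qed
    have bottom: "continuous_on (closed_segment ?a1 ?a2) F"
      unfolding F_def by (intro continuous_intros holomorphic_on_imp_continuous_on holomorphic_cosh ballI ne0)
    have top_path: "linepath ?a4 ?a3 = (+) (\<i> * pi) \<circ> linepath ?a1 ?a2"
      by (auto simp: linepath_def complex_eq_iff fun_eq_iff algebra_simps)
    have top: "(F has_contour_integral - e * contour_integral (linepath ?a1 ?a2) F) (linepath ?a4 ?a3)"
      unfolding top_path has_contour_integral_translate shift
      by (intro has_contour_integral_lmul has_contour_integral_integral contour_integrable_continuous_linepath bottom)
    have J: "contour_integral (linepath ?a1 ?a2) F = J R"
      using that unfolding J_def F_def
      by (subst contour_integral_linepath_Reals_eq) (auto simp: cosh_real complex_is_Real_iff mult_ac)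
    have top': "(F has_contour_integral e * J R) (linepath ?a3 ?a4)"
      using has_contour_integral_reverse_linepath[OF top] J by simp
    have left: "(F has_contour_integral - contour_integral (linepath ?a1 ?a4) F) (linepath ?a4 ?a1)"
      using that by (intro has_contour_integral_reverse_linepath has_contour_integral_integral 
        contour_integrable_continuous_linepath cont_vert) auto
    have right: "(F has_contour_integral contour_integral (linepath ?a2 ?a3) F) (linepath ?a2 ?a3)"
      using that by (intro has_contour_integral_integral contour_integrable_continuous_linepath cont_vert) auto
    have bot': "(F has_contour_integral J R) (linepath ?a1 ?a2)"
      using has_contour_integral_integral[OF contour_integrable_continuous_linepath[OF bottom]] J by simp
    have "(F has_contour_integral J R + (contour_integral (linepath ?a2 ?a3) F + (e * J R +
          - contour_integral (linepath ?a1 ?a4) F))) (rectpath ?a1 ?a3)"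
      unfolding rectpath_def Let_def complex.sel
      by (intro has_contour_integral_join bot' right top' left valid_path_join valid_path_linepath) simp_all
    note sides = contour_integral_unique[OF this]
    have total: "contour_integral (rectpath ?a1 ?a3) F = of_real (2 * pi * exp (- (pi * t / 2)))"
      unfolding F_def by (rule contour_integral_sech_rect[OF that])
    have "j + (a + (e * j + - b)) = j * (1 + e) + (a - b)" for a b e j :: complex
      by (simp add: algebra_simps)
    then have "J R * (1 + e) + V R = J R + (contour_integral (linepath ?a2 ?a3) F + (e * J R +
          - contour_integral (linepath ?a1 ?a4) F))"
      unfolding V_def by metis
    then show ?thesis using sides total by metis
  qed
  have "(\<lambda>n. V (real n)) \<longlonglongrightarrow> 0"
  proof (rule Lim_null_comparison)
    show "eventually (\<lambda>n. cmod (V (real n)) \<le> 2 * (exp (\<bar>t\<bar> * pi) / sinh (real n) * pi)) sequentially"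
      using eventually_gt_at_top[of 0]
    proof eventually_elim
      case (elim n)
      let ?K = "exp (\<bar>t\<bar> * pi) / sinh (real n) * pi"
      have "cmod (contour_integral (linepath (Complex (real n) 0) (Complex (real n) pi)) F) \<le> ?K"
        using vert[of "real n"] elim by simp
      moreover have "cmod (contour_integral (linepath (Complex (- real n) 0) (Complex (- real n) pi)) F) \<le> ?K"
        using vert[of "- real n"] elim by simp
      ultimately have "cmod (V (real n)) \<le> ?K + ?K"
        unfolding V_def by (rule norm_triangle_le_diff[OF add_mono])
      then show ?case by (simp only: mult_2)
    qed
    show "(\<lambda>n. 2 * (exp (\<bar>t\<bar> * pi) / sinh (real n) * pi)) \<longlonglongrightarrow> 0"
      by (intro tendsto_mult_right_zero tendsto_mult_left_zero tendsto_divide_0[OF tendsto_const]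
        filterlim_at_top_imp_at_infinity filterlim_compose[OF sinh_real_at_top filterlim_real_sequentially])
  qed
  moreover have "(\<lambda>n. J (real n)) \<longlonglongrightarrow> ?I"
    unfolding J_def by (intro integral_symmetric_intervals_tendsto integrable_fourier_sech)
  ultimately have "(\<lambda>n. J (real n) * (1 + e) + V (real n)) \<longlonglongrightarrow> ?I * (1 + e) + 0"
    by (intro tendsto_intros)
  moreover have "eventually (\<lambda>n. J (real n) * (1 + e) + V (real n) = of_real (2 * pi * exp (- (pi * t / 2)))) sequentially"
    using eventually_gt_at_top[of 0] by eventually_elim (rule rect, simp)
  then have "(\<lambda>n. J (real n) * (1 + e) + V (real n)) \<longlonglongrightarrow> of_real (2 * pi * exp (- (pi * t / 2)))"
    by (rule tendsto_eventually)
  ultimately have eq: "?I * (1 + e) + 0 = of_real (2 * pi * exp (- (pi * t / 2)))"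
    by (rule LIMSEQ_unique)
  have cosh: "1 + exp (- (pi * t)) = 2 * exp (- (pi * t / 2)) * cosh (pi * t / 2)"
    using one_plus_exp_cosh[of "pi * t / 2"] by simp
  have "2 * pi * exp (- (pi * t / 2)) = pi / cosh (pi * t / 2) * (1 + exp (- (pi * t)))"
    unfolding cosh by simp
  then have "of_real (2 * pi * exp (- (pi * t / 2))) = of_real (pi / cosh (pi * t / 2)) * (1 + e)"
    unfolding e_def by (metis of_real_1 of_real_add of_real_mult)
  with eq have "?I * (1 + e) = of_real (pi / cosh (pi * t / 2)) * (1 + e)"
    by (metis add_0_right)
  moreover have "1 + e \<noteq> 0"
  proof -
    have "1 + exp (- (pi * t)) \<noteq> 0" using exp_gt_zero[of "- (pi * t)"] by linarith
    then show ?thesis unfolding e_def by (metis of_real_1 of_real_add of_real_eq_0_iff)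
  qed
  ultimately show ?thesis by (metis mult_right_cancel)
qed

section \<open>Solving the functional equation\<close>

text \<open>
  The factor \<open>4\<^sup>n\<close> is the inverse square of the scaling factor \<open>1/2\<^sup>n\<close>, so the limit sees the
  coefficient of \<open>u\<^sup>2\<close> in the expansion of \<open>g\<close> at \<open>0\<close>.
\<close>

lemma dyadic_rescaling_limit:
  fixes g :: "real \<Rightarrow> real" and c :: real
  assumes "((\<lambda>u. g u / u\<^sup>2) \<longlongrightarrow> L) (at_right 0)" "g 0 = 0" "c \<ge> 0"
  shows "(\<lambda>n. 4 ^ n * g (c / 2 ^ n)) \<longlonglongrightarrow> c\<^sup>2 * L"
proof (cases "c = 0")
  case False
  with assms(3) have "c > 0" by simp
  then have "filterlim (\<lambda>n. c / 2 ^ n) (at_right 0) sequentially" by real_asymp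
  with assms(1) have "(\<lambda>n. g (c / 2 ^ n) / (c / 2 ^ n)\<^sup>2) \<longlonglongrightarrow> L" by (rule filterlim_compose)
  then have "(\<lambda>n. c\<^sup>2 * (g (c / 2 ^ n) / (c / 2 ^ n)\<^sup>2)) \<longlonglongrightarrow> c\<^sup>2 * L" by (intro tendsto_intros)
  moreover have "c\<^sup>2 * (g (c / 2 ^ n) / (c / 2 ^ n)\<^sup>2) = 4 ^ n * g (c / 2 ^ n)" for n
  proof -
    have "(c / 2 ^ n)\<^sup>2 = c\<^sup>2 / 4 ^ n"
      by (simp add: power_divide power2_eq_square flip: power_mult_distrib)
    then show ?thesis using False by simp
  qed
  ultimately show ?thesis by simp
qed (use assms in simp)

lemma sech_dyadic_limit:
  fixes c :: real
  assumes "c \<ge> 0"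
  shows "(\<lambda>n. 4 ^ n * (1 - 1 / cosh (c / 2 ^ n))) \<longlonglongrightarrow> c\<^sup>2 / 2"
proof -
  have "((\<lambda>u::real. (1 - 1 / ((exp u + exp (- u)) / 2)) / u\<^sup>2) \<longlongrightarrow> 1 / 2) (at_right 0)"
    by real_asymp
  then have "((\<lambda>u::real. (1 - 1 / cosh u) / u\<^sup>2) \<longlongrightarrow> 1 / 2) (at_right 0)"
    by (simp only: cosh_field_def)
  from dyadic_rescaling_limit[OF this _ assms] show ?thesis by simp
qed

lemma cos_dyadic_limit: "(\<lambda>n. 4 ^ n * (1 - cos (y / 2 ^ n))) \<longlonglongrightarrow> y\<^sup>2 / 2" for y :: real
proof -
  have "((\<lambda>u::real. (1 - cos u) / u\<^sup>2) \<longlongrightarrow> 1 / 2) (at_right 0)"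
    by real_asymp
  from dyadic_rescaling_limit[OF this, of "\<bar>y\<bar>"]
  have "(\<lambda>n. 4 ^ n * (1 - cos (\<bar>y\<bar> / 2 ^ n))) \<longlonglongrightarrow> y\<^sup>2 / 2" by simp
  moreover have "cos (\<bar>y\<bar> / 2 ^ n) = cos (y / 2 ^ n)" for n by (simp add: abs_if)
  ultimately show ?thesis by simp
qed

lemma one_minus_cos_le: "1 - cos y \<le> y\<^sup>2 / 2" for y :: real
proof -
  have "\<bar>sin (y / 2)\<bar>\<^sup>2 \<le> \<bar>y / 2\<bar>\<^sup>2" by (intro power_mono abs_sin_x_le_abs_x) simp
  then have "2 * (sin (y / 2))\<^sup>2 \<le> y\<^sup>2 / 2" by (simp add: power_divide)
  moreover have "cos y = 1 - 2 * (sin (y / 2))\<^sup>2" using cos_double_sin[of "y / 2"] by simp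
  ultimately show ?thesis by simp
qed

text \<open>
  Positivity of \<open>f\<close> comes from the equivalent form \<open>f(t) = f(t/2)\<^sup>2 / (2 - f(t/2)\<^sup>2)\<close>: it propagates
  positivity from \<open>t/2\<close> to \<open>t\<close>, and near \<open>0\<close> continuity gives it.  With \<open>h = arcosh(1/f)\<close> the equation
  becomes \<open>cosh(h(t)) = cosh(2 h(t/2))\<close>.  The limit of \<open>4\<^sup>n (1 - f(t/2\<^sup>n))\<close> is then computed twice,
  once from \<open>h(t/2\<^sup>n) = h(t)/2\<^sup>n\<close> and once under the expectation.
\<close>

lemma halving_equation_imp_sech:
  fixes \<mu> :: "real measure" and f :: "real \<Rightarrow> real"
  assumes "real_distribution \<mu>"
    and char: "\<And>t. char \<mu> t = of_real (f t)"
    and eq: "\<And>t. f t = (f (t / 2))\<^sup>2 * (1 + f t) / 2"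
  shows "\<exists>\<sigma>\<ge>0. \<forall>t. f t = 1 / cosh (\<sigma> * t)"
proof -
  interpret real_distribution \<mu> by fact
  have int_cos: "integrable \<mu> (\<lambda>x. cos (t * x))" for t
    by (rule integrable_const_bound[of _ 1]) auto
  have f_cos: "f t = (\<integral>x. cos (t * x) \<partial>\<mu>)" for t
  proof -
    have "integrable \<mu> (\<lambda>x. iexp (t * x))" by (rule integrable_iexp) auto
    then have "Re (char \<mu> t) = (\<integral>x. Re (iexp (t * x)) \<partial>\<mu>)" by (simp add: char_def)
    then show ?thesis using char by (simp add: Re_exp)
  qed
  have f_one_minus: "1 - f t = (\<integral>x. 1 - cos (t * x) \<partial>\<mu>)" for t
    using int_cos[of t] prob_space by (simp add: f_cos del: space_eq_univ)
  have f_0: "f 0 = 1" using char_zero char[of 0] by simp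
  have f_le: "\<bar>f t\<bar> \<le> 1" for t using cmod_char_le_1[of t] by (simp add: char)
  have f_cont: "isCont f 0"
  proof -
    have "isCont (\<lambda>t. Re (char \<mu> t)) 0"
      using isCont_char[of 0] unfolding isCont_def by (rule tendsto_Re)
    then show ?thesis by (simp add: char)
  qed
  have f_sq_less: "(f t)\<^sup>2 < 2" for t using power_mono[OF f_le[of t], of 2] by simp
  have f_step: "f t = (f (t / 2))\<^sup>2 / (2 - (f (t / 2))\<^sup>2)" for t
    using eq[of t] f_sq_less[of "t / 2"] by (simp add: field_simps)
  have f_pos: "f t > 0" for t
  proof -
    have shrink: "(\<lambda>n. t / 2 ^ n) \<longlonglongrightarrow> 0" by real_asymp
    have "(\<lambda>n. f (t / 2 ^ n)) \<longlonglongrightarrow> f 0" by (rule isCont_tendsto_compose[OF f_cont shrink])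
    then have "eventually (\<lambda>n. f (t / 2 ^ n) > 0) sequentially"
      by (rule order_tendstoD) (simp add: f_0)
    then obtain n where "f (t / 2 ^ n) > 0" by (auto simp: eventually_sequentially)
    then show ?thesis
    proof (induction n)
      case (Suc n)
      have "f (t / 2 ^ n) > 0"
        using Suc.prems f_sq_less[of "t / 2 ^ Suc n"] by (subst f_step) (simp add: mult.commute)
      then show ?case by (rule Suc.IH)
    qed simp
  qed
  define h where "h t = arcosh (1 / f t)" for t
  have inv_ge: "1 / f t \<ge> 1" for t using f_pos[of t] f_le[of t] by simp
  have cosh_h: "cosh (h t) = 1 / f t" and h_nonneg: "h t \<ge> 0" for t
    using inv_ge[of t] by (simp_all add: h_def)
  have f_h: "f t = 1 / cosh (h t)" for t by (simp add: cosh_h)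
  have h_half: "h t = 2 * h (t / 2)" for t
  proof -
    have "cosh (2 * h (t / 2)) = 2 / (f (t / 2))\<^sup>2 - 1"
      by (simp add: cosh_double_cosh cosh_h power_divide)
    also have "\<dots> = 1 / f t"
      using f_pos[of "t / 2"] f_sq_less[of "t / 2"] by (subst f_step) (simp add: field_simps)
    finally show ?thesis using arcosh_cosh_real[of "2 * h (t / 2)"] h_nonneg by (simp add: h_def)
  qed
  have h_pow: "h (t / 2 ^ n) = h t / 2 ^ n" for t n
  proof (induction n)
    case (Suc n)
    then show ?case using h_half[of "t / 2 ^ n"] by (simp add: mult.commute)
  qed simp
  have lim: "(\<lambda>n. \<integral>x. 4 ^ n * (1 - cos (t / 2 ^ n * x)) \<partial>\<mu>) \<longlonglongrightarrow> (h t)\<^sup>2 / 2" for t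
  proof -
    have "(\<integral>x. 4 ^ n * (1 - cos (t / 2 ^ n * x)) \<partial>\<mu>) = 4 ^ n * (1 - 1 / cosh (h t / 2 ^ n))" for n
      using f_one_minus[of "t / 2 ^ n"] by (simp add: f_h h_pow)
    then show ?thesis using sech_dyadic_limit[OF h_nonneg] by simp
  qed
  \<comment> \<open>Fatou's lemma for the limit at \<open>t = 1\<close>: the integrands are nonnegative and tend to \<open>x\<^sup>2/2\<close>.\<close>
  have second_moment: "integrable \<mu> (\<lambda>x. x\<^sup>2)"
  proof -
    let ?g = "\<lambda>n x. 4 ^ n * (1 - cos (1 / 2 ^ n * x)) :: real"
    have "(\<integral>\<^sup>+x. ennreal (x\<^sup>2 / 2) \<partial>\<mu>) = (\<integral>\<^sup>+x. liminf (\<lambda>n. ennreal (?g n x)) \<partial>\<mu>)"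
    proof (intro nn_integral_cong)
      fix x :: real
      have "(\<lambda>n. ennreal (?g n x)) \<longlonglongrightarrow> ennreal (x\<^sup>2 / 2)"
        using cos_dyadic_limit[of x] by (intro tendsto_ennrealI) simp
      then show "ennreal (x\<^sup>2 / 2) = liminf (\<lambda>n. ennreal (?g n x))"
        by (intro lim_imp_Liminf[symmetric]) auto
    qed
    also have "\<dots> \<le> liminf (\<lambda>n. \<integral>\<^sup>+x. ennreal (?g n x) \<partial>\<mu>)"
      by (rule nn_integral_liminf) simp
    also have "(\<lambda>n. \<integral>\<^sup>+x. ennreal (?g n x) \<partial>\<mu>) = (\<lambda>n. ennreal (\<integral>x. ?g n x \<partial>\<mu>))"
    proof
      fix n show "(\<integral>\<^sup>+x. ennreal (?g n x) \<partial>\<mu>) = ennreal (\<integral>x. ?g n x \<partial>\<mu>)"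
        using int_cos[of "1 / 2 ^ n"] by (intro nn_integral_eq_integral) auto
    qed
    also have "liminf \<dots> = ennreal ((h 1)\<^sup>2 / 2)"
      by (intro lim_imp_Liminf tendsto_ennrealI lim) simp
    also have "\<dots> < \<infinity>" by simp
    finally have "integrable \<mu> (\<lambda>x. x\<^sup>2 / 2)" by (intro integrableI_nonneg) auto
    then have "integrable \<mu> (\<lambda>x. 2 * (x\<^sup>2 / 2))" by (rule integrable_mult_right)
    then show ?thesis by simp
  qed
  define m where "m = (\<integral>x. x\<^sup>2 \<partial>\<mu>)"
  have m_nonneg: "m \<ge> 0" unfolding m_def by (rule integral_nonneg_AE) simp
  \<comment> \<open>Now that \<open>x\<^sup>2\<close> is integrable it dominates, as \<open>1 - cos y \<le> y\<^sup>2/2\<close>.\<close>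
  have h_sq: "(h t)\<^sup>2 = t\<^sup>2 * m" for t
  proof -
    have "(\<lambda>n. \<integral>x. 4 ^ n * (1 - cos (t / 2 ^ n * x)) \<partial>\<mu>) \<longlonglongrightarrow> (\<integral>x. (t * x)\<^sup>2 / 2 \<partial>\<mu>)"
    proof (rule integral_dominated_convergence[where w = "\<lambda>x. (t * x)\<^sup>2 / 2"])
      show "integrable \<mu> (\<lambda>x. (t * x)\<^sup>2 / 2)" using second_moment by (simp add: power_mult_distrib)
      show "AE x in \<mu>. (\<lambda>n. 4 ^ n * (1 - cos (t / 2 ^ n * x))) \<longlonglongrightarrow> (t * x)\<^sup>2 / 2"
        using cos_dyadic_limit[of "t * _"] by simp
      show "AE x in \<mu>. norm (4 ^ n * (1 - cos (t / 2 ^ n * x))) \<le> (t * x)\<^sup>2 / 2" for n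
      proof (rule AE_I2)
        fix x
        have "4 ^ n * (1 - cos (t / 2 ^ n * x)) \<le> 4 ^ n * ((t / 2 ^ n * x)\<^sup>2 / 2)"
          by (intro mult_left_mono one_minus_cos_le) simp
        also have "\<dots> = (t * x)\<^sup>2 / 2"
        proof -
          have "(2 ^ n)\<^sup>2 = (4 ^ n :: real)" by (simp add: power2_eq_square flip: power_mult_distrib)
          then show ?thesis by (simp add: power_mult_distrib power_divide)
        qed
        finally show "norm (4 ^ n * (1 - cos (t / 2 ^ n * x))) \<le> (t * x)\<^sup>2 / 2" by simp
      qed
    qed simp_all
    with lim[of t] have "(h t)\<^sup>2 / 2 = (\<integral>x. (t * x)\<^sup>2 / 2 \<partial>\<mu>)" by (rule LIMSEQ_unique)
    then show ?thesis by (simp add: power_mult_distrib m_def)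
  qed
  have "f t = 1 / cosh (sqrt m * t)" for t
  proof -
    \<comment> \<open>\<open>h\<close> is nonnegative, whence the absolute value; \<open>cosh\<close> is even and forgets it.\<close>
    have "(h t)\<^sup>2 = (\<bar>sqrt m * t\<bar>)\<^sup>2" using m_nonneg by (simp add: h_sq power_mult_distrib)
    then have "h t = \<bar>sqrt m * t\<bar>" using h_nonneg[of t] power2_eq_imp_eq by fastforce
    then show ?thesis by (simp add: f_h abs_if)
  qed
  then show ?thesis using m_nonneg by (intro exI[of _ "sqrt m"]) simp
qed

section \<open>The hyperbolic secant law\<close>

lemma hyperbolic_secant_density_nonneg: "a > 0 \<Longrightarrow> hyperbolic_secant_density a x \<ge> 0"
  by (simp add: hyperbolic_secant_density_def)

lemma hyperbolic_secant_density_measurable [measurable]: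
  "hyperbolic_secant_density a \<in> borel_measurable borel"
  unfolding hyperbolic_secant_density_def
  by (cases "a = 0") (auto intro!: borel_measurable_continuous_onI continuous_intros)

abbreviation hyperbolic_secant_measure :: "real \<Rightarrow> real measure" where
  "hyperbolic_secant_measure a \<equiv> density lborel (\<lambda>x. ennreal (hyperbolic_secant_density a x))"

lemma char_hyperbolic_secant:
  assumes "a > 0"
  shows "char (hyperbolic_secant_measure a) t = of_real (1 / cosh (pi * a * t / 2))"
proof -
  let ?f = "\<lambda>x. hyperbolic_secant_density a x *\<^sub>R iexp (t * x)"
  have "char (hyperbolic_secant_measure a) t = (\<integral>x. ?f x \<partial>lborel)"
    unfolding char_def
    by (rule integral_density) (use assms hyperbolic_secant_density_nonneg in auto)
  also have "\<dots> = \<bar>a\<bar> *\<^sub>R (\<integral>x. ?f (0 + a * x) \<partial>lborel)"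
    by (rule lborel_integral_real_affine) (use assms in simp)
  also have "\<dots> = \<bar>a\<bar> *\<^sub>R (\<integral>x. of_real (1 / (pi * a)) * (iexp ((a * t) * x) / complex_of_real (cosh x)) \<partial>lborel)"
    using assms by (simp add: hyperbolic_secant_density_def scaleR_conv_of_real mult_ac)
  also have "\<dots> = of_real (a * (1 / (pi * a)) * (pi / cosh (pi * (a * t) / 2)))"
    unfolding integral_mult_right_zero fourier_sech using assms
    by (simp only: scaleR_conv_of_real of_real_mult abs_of_pos mult.assoc)
  also have "a * (1 / (pi * a)) * (pi / cosh (pi * (a * t) / 2)) = 1 / cosh (pi * a * t / 2)"
    using assms by (simp add: mult.assoc)
  finally show ?thesis .
qed

text \<open>
  The total mass of a density is the value at \<open>0\<close> of its Fourier transform, and \<open>cosh 0 = 1\<close>.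
\<close>

lemma real_distribution_hyperbolic_secant:
  assumes "a > 0"
  shows "real_distribution (hyperbolic_secant_measure a)"
proof -
  have "integrable lborel (\<lambda>x. 1 / cosh (0 + (1 / a) * x))"
    using assms by (intro lborel_integrable_real_affine[OF integrable_sech]) simp
  then have "integrable lborel (\<lambda>x. (1 / (pi * a)) * (1 / cosh (0 + (1 / a) * x)))"
    by (rule integrable_mult_right)
  then have int: "integrable lborel (hyperbolic_secant_density a)"
    unfolding hyperbolic_secant_density_def by simp
  have "of_real (\<integral>x. hyperbolic_secant_density a x \<partial>lborel) = char (hyperbolic_secant_measure a) 0"
    unfolding char_def
    by (subst integral_density) (use assms hyperbolic_secant_density_nonneg in \<open>auto simp: scaleR_conv_of_real\<close>)
  also have "\<dots> = 1" by (simp add: char_hyperbolic_secant[OF assms])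
  finally have "(\<integral>x. hyperbolic_secant_density a x \<partial>lborel) = 1"
    by (simp only: of_real_eq_1_iff)
  then have "emeasure (hyperbolic_secant_measure a) (space (hyperbolic_secant_measure a)) = 1"
    using assms int hyperbolic_secant_density_nonneg
    by (simp add: emeasure_density nn_integral_eq_integral)
  then interpret prob_space "hyperbolic_secant_measure a" by (rule prob_spaceI)
  show ?thesis by unfold_locales simp_all
qed

section \<open>The characteristic function of the right-hand side\<close>

lemma char_distr_scale:
  assumes "X \<in> borel_measurable M"
  shows "char (distr M borel (\<lambda>\<omega>. c * X \<omega>)) t = char (distr M borel X) (c * t)"
  using assms by (simp add: char_def integral_distr mult_ac)

text \<open>
  Replacing \<open>X\<close> by \<open>-X\<close> conjugates the characteristic function, so symmetry makes it real.
\<close>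

lemma char_symmetric_dist:
  assumes "X \<in> borel_measurable M" "symmetric_dist M X"
  shows "char (distr M borel X) t = of_real (Re (char (distr M borel X) t))"
proof -
  let ?\<phi> = "char (distr M borel X)"
  have "?\<phi> t = ?\<phi> (- t)"
    using assms(2) char_distr_scale[OF assms(1), of "-1" t]
    by (simp add: symmetric_dist_def eq_in_dist_def)
  also have "\<dots> = cnj (?\<phi> t)"
    unfolding char_def by (simp add: exp_cnj flip: Bochner_Integration.integral_cnj)
  finally show ?thesis by (simp add: complex_eq_iff)
qed

text \<open>
  Two measures agreeing on rectangles coincide, and on rectangles the claim is the definition of
  independence.
\<close>

lemma indep_rv_distr_pair:
  assumes "prob_space M" "indep_rv M N Y K Z"
  shows "distr M (N \<Otimes>\<^sub>M K) (\<lambda>\<omega>. (Y \<omega>, Z \<omega>)) = distr M N Y \<Otimes>\<^sub>M distr M K Z"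
proof -
  interpret prob_space M by fact
  from assms(2) have meas [measurable]: "Y \<in> measurable M N" "Z \<in> measurable M K"
    and ind: "indep_set {Y -` A \<inter> space M |A. A \<in> sets N} {Z -` B \<inter> space M |B. B \<in> sets K}"
    by (auto simp: indep_rv_def)
  interpret Y: prob_space "distr M N Y" by (rule prob_space_distr) fact
  interpret Z: prob_space "distr M K Z" by (rule prob_space_distr) fact
  show ?thesis
  proof (rule pair_measure_eqI[symmetric])
    fix A B assume "A \<in> sets (distr M N Y)" "B \<in> sets (distr M K Z)"
    then have AB [measurable]: "A \<in> sets N" "B \<in> sets K" by simp_all
    have "prob ((Y -` A \<inter> space M) \<inter> (Z -` B \<inter> space M)) = prob (Y -` A \<inter> space M) * prob (Z -` B \<inter> space M)"
      by (rule indep_setD[OF ind]) (use AB in blast)+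
    moreover have "(\<lambda>\<omega>. (Y \<omega>, Z \<omega>)) -` (A \<times> B) \<inter> space M = (Y -` A \<inter> space M) \<inter> (Z -` B \<inter> space M)"
      by auto
    ultimately show "emeasure (distr M N Y) A * emeasure (distr M K Z) B =
        emeasure (distr M (N \<Otimes>\<^sub>M K) (\<lambda>\<omega>. (Y \<omega>, Z \<omega>))) (A \<times> B)"
      by (simp add: emeasure_distr emeasure_eq_measure ennreal_mult'')
  qed (simp_all add: Y.sigma_finite_measure_axioms Z.sigma_finite_measure_axioms cong: sets_pair_measure_cong)
qed

text \<open>
  Conditioning on \<open>\<epsilon>\<close>: by independence the joint law of \<open>\<epsilon>\<close> and \<open>Z\<close> is a product, Fubini's theorem
  integrates over \<open>Z\<close> first, and what remains is an average over the two values of \<open>\<epsilon>\<close>.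
\<close>

lemma integral_fair_bernoulli_mixture:
  fixes g :: "real \<Rightarrow> 'b \<Rightarrow> complex"
  assumes "prob_space M" "fair_bernoulli M \<epsilon>" and ind: "indep_rv M borel \<epsilon> K Z"
    and meas: "(\<lambda>(e, z). g e z) \<in> borel_measurable (borel \<Otimes>\<^sub>M K)"
    and bound: "\<And>e z. cmod (g e z) \<le> 1"
  shows "(\<integral>\<omega>. g (\<epsilon> \<omega>) (Z \<omega>) \<partial>M) = ((\<integral>\<omega>. g 0 (Z \<omega>) \<partial>M) + (\<integral>\<omega>. g 1 (Z \<omega>) \<partial>M)) / 2"
proof -
  interpret prob_space M by fact
  from ind have [measurable]: "\<epsilon> \<in> borel_measurable M" "Z \<in> measurable M K"
    by (auto simp: indep_rv_def)
  interpret E: prob_space "distr M borel \<epsilon>" by (rule prob_space_distr) simp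
  interpret Z: prob_space "distr M K Z" by (rule prob_space_distr) simp
  interpret P: pair_prob_space "distr M borel \<epsilon>" "distr M K Z" ..
  note [measurable] = meas
  have gm [measurable]: "g e \<in> borel_measurable K" for e
    using measurable_compose[OF measurable_Pair1' meas, of e] by simp
  have "(\<integral>\<omega>. g (\<epsilon> \<omega>) (Z \<omega>) \<partial>M) = (\<integral>p. (\<lambda>(e, z). g e z) p \<partial>distr M (borel \<Otimes>\<^sub>M K) (\<lambda>\<omega>. (\<epsilon> \<omega>, Z \<omega>)))"
    by (subst integral_distr) (simp_all add: meas)
  also have "\<dots> = (\<integral>p. (\<lambda>(e, z). g e z) p \<partial>(distr M borel \<epsilon> \<Otimes>\<^sub>M distr M K Z))"
    by (simp add: indep_rv_distr_pair[OF assms(1) ind])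
  also have "\<dots> = (\<integral>e. \<integral>z. g e z \<partial>distr M K Z \<partial>distr M borel \<epsilon>)"
    by (subst P.integral_fst'[symmetric]) 
      (auto intro!: P.integrable_const_bound[of _ 1] bound simp: meas split: prod.split cong: measurable_cong_sets sets_pair_measure_cong)
  also have "\<dots> = (\<integral>e. \<integral>\<omega>. g e (Z \<omega>) \<partial>M \<partial>distr M borel \<epsilon>)"
    by (simp add: integral_distr)
  also have "\<dots> = (\<integral>e. \<integral>\<omega>. g e (Z \<omega>) \<partial>M \<partial>distr (measure_pmf (bernoulli_pmf (1/2))) borel of_bool)"
    using assms(2) by (simp add: fair_bernoulli_def)
  also have "\<dots> = (\<integral>b. \<integral>\<omega>. g (of_bool b) (Z \<omega>) \<partial>M \<partial>measure_pmf (bernoulli_pmf (1/2)))"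
    by (intro integral_distr) simp_all
  also have "\<dots> = ((\<integral>\<omega>. g 0 (Z \<omega>) \<partial>M) + (\<integral>\<omega>. g 1 (Z \<omega>) \<partial>M)) / 2"
    by (subst integral_measure_pmf[of UNIV]) (simp_all add: UNIV_bool scaleR_conv_of_real add_divide_distrib)
  finally show ?thesis .
qed

text \<open>
  For \<open>\<epsilon> = 0\<close> the variable is \<open>(X\<^sub>1 + X\<^sub>2)/2\<close>, for \<open>\<epsilon> = 1\<close> it is \<open>(X\<^sub>1 + X\<^sub>2)/2 + X\<^sub>3\<close>; each is a sum of
  independent variables, so its characteristic function is a product.
\<close>

lemma char_half_sum_plus_bernoulli_multiple:
  fixes X :: "nat \<Rightarrow> 'a \<Rightarrow> real"
  assumes "prob_space M"
    and indep: "prob_space.indep_vars M (\<lambda>_. borel) X {1, 2, 3}"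
    and ident: "\<forall>i\<in>{1, 2, 3}. \<forall>j\<in>{1, 2, 3}. eq_in_dist M (X i) (X j)"
    and bernoulli: "fair_bernoulli M \<epsilon>"
    and indep_eps: "indep_rv M borel \<epsilon> borel (\<lambda>\<omega>. (X 1 \<omega>, X 2 \<omega>, X 3 \<omega>))"
  shows "char (distr M borel (\<lambda>\<omega>. (X 1 \<omega> + X 2 \<omega>) / 2 + \<epsilon> \<omega> * X 3 \<omega>)) t =
    (char (distr M borel (X 1)) (t / 2))\<^sup>2 * (1 + char (distr M borel (X 1)) t) / 2"
proof -
  interpret prob_space M by fact
  let ?\<phi> = "char (distr M borel (X 1))"
  note [simp del] = One_nat_def
  have X: "X i \<in> borel_measurable M" if "i \<in> {1, 2, 3}" for i
    using indep that unfolding indep_vars_def2 by blast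
  have [measurable]: "X 1 \<in> borel_measurable M" "X 2 \<in> borel_measurable M" "X 3 \<in> borel_measurable M"
    by (rule X, simp)+
  have [measurable]: "\<epsilon> \<in> borel_measurable M" using indep_eps unfolding indep_rv_def by blast
  have same: "distr M borel (X 2) = distr M borel (X 1)" "distr M borel (X 3) = distr M borel (X 1)"
    using ident unfolding eq_in_dist_def by blast+
  \<comment> \<open>The two sums are \<open>\<Sum>i\<in>I. c i * X i\<close> for \<open>I = {1, 2}\<close> and \<open>I = {1, 2, 3}\<close>.\<close>
  define c :: "nat \<Rightarrow> real" where "c i = (if i = 3 then 1 else 1 / 2)" for i
  have indep_c: "indep_vars (\<lambda>_. borel) (\<lambda>i \<omega>. c i * X i \<omega>) {1, 2, 3}"
    by (rule indep_vars_compose2[OF indep]) simp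
  have char_c: "char (distr M borel (\<lambda>\<omega>. \<Sum>i\<in>I. c i * X i \<omega>)) t = (\<Prod>i\<in>I. char (distr M borel (X i)) (c i * t))"
    if "I \<subseteq> {1, 2, 3}" for I
  proof -
    have "char (distr M borel (\<lambda>\<omega>. \<Sum>i\<in>I. c i * X i \<omega>)) t = (\<Prod>i\<in>I. char (distr M borel (\<lambda>\<omega>. c i * X i \<omega>)) t)"
      by (rule char_distr_sum[OF indep_vars_subset[OF indep_c that]])
    also have "\<dots> = (\<Prod>i\<in>I. char (distr M borel (X i)) (c i * t))"
      by (intro prod.cong refl char_distr_scale) (use that X in auto)
    finally show ?thesis .
  qed
  have two: "(\<integral>\<omega>. iexp (t * ((X 1 \<omega> + X 2 \<omega>) / 2)) \<partial>M) = (?\<phi> (t / 2))\<^sup>2"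
    using char_c[of "{1, 2}"]
    by (simp add: c_def same char_def[of "distr M borel (\<lambda>\<omega>. X 1 \<omega> / 2 + X 2 \<omega> / 2)"] integral_distr add_divide_distrib power2_eq_square)
  have three: "(\<integral>\<omega>. iexp (t * ((X 1 \<omega> + X 2 \<omega>) / 2 + X 3 \<omega>)) \<partial>M) = (?\<phi> (t / 2))\<^sup>2 * ?\<phi> t"
    using char_c[of "{1, 2, 3}"]
    by (simp add: c_def same char_def[of "distr M borel (\<lambda>\<omega>. X 1 \<omega> / 2 + (X 2 \<omega> / 2 + X 3 \<omega>))"] integral_distr add_divide_distrib power2_eq_square add.assoc mult.assoc)
  define g where "g e z = iexp (t * ((fst z + fst (snd z)) / 2 + e * snd (snd z)))" for e :: real and z :: "real \<times> real \<times> real"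
  have g01: "g 0 (x, y, z) = iexp (t * ((x + y) / 2))" "g 1 (x, y, z) = iexp (t * ((x + y) / 2 + z))" for x y z
    by (simp_all only: g_def fst_conv snd_conv mult_zero_left add_0_right mult_1)
  have "char (distr M borel (\<lambda>\<omega>. (X 1 \<omega> + X 2 \<omega>) / 2 + \<epsilon> \<omega> * X 3 \<omega>)) t
      = (\<integral>\<omega>. g (\<epsilon> \<omega>) (X 1 \<omega>, X 2 \<omega>, X 3 \<omega>) \<partial>M)"
    unfolding char_def g_def by (subst integral_distr) simp_all
  also have "\<dots> = ((\<integral>\<omega>. g 0 (X 1 \<omega>, X 2 \<omega>, X 3 \<omega>) \<partial>M) + (\<integral>\<omega>. g 1 (X 1 \<omega>, X 2 \<omega>, X 3 \<omega>) \<partial>M)) / 2"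
  proof (rule integral_fair_bernoulli_mixture[OF assms(1) bernoulli indep_eps])
    show "(\<lambda>(e, z). g e z) \<in> borel_measurable (borel \<Otimes>\<^sub>M borel)"
      unfolding g_def borel_prod case_prod_beta
      by (intro borel_measurable_continuous_onI continuous_intros) simp_all
    show "cmod (g e z) \<le> 1" for e z unfolding g_def by (simp only: norm_exp_i_times)
  qed
  also have "\<dots> = ((?\<phi> (t / 2))\<^sup>2 + (?\<phi> (t / 2))\<^sup>2 * ?\<phi> t) / 2"
    unfolding g01 two three ..
  finally show ?thesis by (simp add: distrib_left)
qed

section \<open>The characterization\<close>

text \<open>
  The constant \<open>1\<close> is the characteristic function of the point mass at \<open>0\<close>.
\<close>

lemma char_one_imp_AE_zero:
  assumes "prob_space M" and X [measurable]: "X \<in> borel_measurable M"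
    and "\<And>t. char (distr M borel X) t = 1"
  shows "AE \<omega> in M. X \<omega> = 0"
proof -
  interpret prob_space M by fact
  interpret D: prob_space "return borel (0::real)" by (rule prob_space_return) simp
  have "char (return borel 0) t = 1" for t
    unfolding char_def by (subst integral_return) simp_all
  then have "distr M borel X = return borel 0"
    using assms(3) by (intro Levy_uniqueness real_distribution_distr X ext)
      (simp_all add: real_distribution_def real_distribution_axioms_def D.prob_space_axioms)
  moreover have "AE x in return borel (0::real). x = 0" by (simp add: AE_return)
  ultimately have "AE x in distr M borel X. x = 0" by metis
  then show ?thesis by (simp add: AE_distr_iff)
qed

text \<open>
  This is \<open>cosh(2u) + 1 = 2 cosh(u)\<^sup>2\<close>, divided by \<open>2 cosh(u)\<^sup>2 cosh(2u)\<close>.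
\<close>

lemma sech_halving: "1 / cosh (2 * u) = (1 / cosh u)\<^sup>2 * (1 + 1 / cosh (2 * u)) / 2" for u :: real
proof -
  have "1 + 1 / cosh (2 * u) = (cosh (2 * u) + 1) / cosh (2 * u)"
    by (simp add: add_divide_distrib)
  moreover have "cosh (2 * u) + 1 = 2 * (cosh u)\<^sup>2" by (simp add: cosh_double_cosh)
  ultimately have "1 + 1 / cosh (2 * u) = 2 * (cosh u)\<^sup>2 / cosh (2 * u)" by simp
  then show ?thesis by (simp add: power_divide)
qed

theorem theorem3p1:
  fixes M :: "'a measure" and X :: "nat \<Rightarrow> 'a \<Rightarrow> real" and \<epsilon> :: "'a \<Rightarrow> real"
  assumes "prob_space M"
    and indep: "prob_space.indep_vars M (\<lambda>_. borel) X {1, 2, 3}"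
    and ident: "\<forall>i\<in>{1, 2, 3}. \<forall>j\<in>{1, 2, 3}. eq_in_dist M (X i) (X j)"
    and symm: "symmetric_dist M (X 1)"
    and nondegenerate: "\<not> (AE \<omega> in M. X 1 \<omega> = 0)"
    and bernoulli: "fair_bernoulli M \<epsilon>"
    and indep_eps: "indep_rv M borel \<epsilon> borel (\<lambda>\<omega>. (X 1 \<omega>, X 2 \<omega>, X 3 \<omega>))"
  shows "eq_in_dist M (X 1) (\<lambda>\<omega>. (X 1 \<omega> + X 2 \<omega>) / 2 + \<epsilon> \<omega> * X 3 \<omega>)
         \<longleftrightarrow> hyperbolic_secant_dist M (X 1)"
proof -
  interpret prob_space M by fact
  note [simp del] = One_nat_def
  let ?\<mu> = "distr M borel (X 1)"
  let ?Y = "\<lambda>\<omega>. (X 1 \<omega> + X 2 \<omega>) / 2 + \<epsilon> \<omega> * X 3 \<omega>"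
  have "X i \<in> borel_measurable M" if "i \<in> {1, 2, 3}" for i
    using indep that unfolding indep_vars_def2 by blast
  then have [measurable]: "X 1 \<in> borel_measurable M" "X 2 \<in> borel_measurable M" "X 3 \<in> borel_measurable M"
    by simp_all
  have [measurable]: "\<epsilon> \<in> borel_measurable M" using indep_eps unfolding indep_rv_def by blast
  have real: "real_distribution ?\<mu>" by (rule real_distribution_distr) simp
  have real_Y: "real_distribution (distr M borel ?Y)" by (rule real_distribution_distr) simp
  have char_Y: "char (distr M borel ?Y) t = (char ?\<mu> (t / 2))\<^sup>2 * (1 + char ?\<mu> t) / 2" for t
    by (rule char_half_sum_plus_bernoulli_multiple[OF assms(1) indep ident bernoulli indep_eps])
  show ?thesis
  proof
    assume "eq_in_dist M (X 1) ?Y"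
    then have char_eq: "char ?\<mu> t = (char ?\<mu> (t / 2))\<^sup>2 * (1 + char ?\<mu> t) / 2" for t
      using char_Y[of t] unfolding eq_in_dist_def by metis
    define f where "f t = Re (char ?\<mu> t)" for t
    have char_f: "char ?\<mu> t = of_real (f t)" for t
      unfolding f_def by (rule char_symmetric_dist) (simp_all add: symm)
    have "f t = (f (t / 2))\<^sup>2 * (1 + f t) / 2" for t
    proof -
      have "complex_of_real (f t) = of_real ((f (t / 2))\<^sup>2 * (1 + f t) / 2)"
        using char_eq[of t] unfolding char_f by simp
      then show ?thesis by (simp only: of_real_eq_iff)
    qed
    with halving_equation_imp_sech[OF real char_f] obtain \<sigma>
      where "\<sigma> \<ge> 0" and f: "\<And>t. f t = 1 / cosh (\<sigma> * t)" by blast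
    \<comment> \<open>A vanishing scale would make \<open>X 1\<close> degenerate at \<open>0\<close>.\<close>
    have "\<sigma> \<noteq> 0"
    proof
      assume "\<sigma> = 0"
      then have "char ?\<mu> t = 1" for t by (simp add: char_f f)
      then have "AE \<omega> in M. X 1 \<omega> = 0" by (intro char_one_imp_AE_zero assms(1)) simp_all
      with nondegenerate show False by contradiction
    qed
    \<comment> \<open>The scale for which \<open>\<pi>at/2 = \<sigma>t\<close>.\<close>
    define a where "a = 2 * \<sigma> / pi"
    have a: "a > 0" using \<open>\<sigma> \<ge> 0\<close> \<open>\<sigma> \<noteq> 0\<close> by (simp add: a_def)
    have "char ?\<mu> = char (hyperbolic_secant_measure a)"
      by (rule ext) (simp add: char_f f char_hyperbolic_secant[OF a], simp add: a_def)
    then have "?\<mu> = hyperbolic_secant_measure a"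
      by (intro Levy_uniqueness real real_distribution_hyperbolic_secant a)
    moreover have "distr M lborel (X 1) = ?\<mu>" by (intro distr_cong) simp_all
    ultimately have "distributed M lborel (X 1) (\<lambda>x. ennreal (hyperbolic_secant_density a x))"
      by (simp add: distributed_def)
    with a show "hyperbolic_secant_dist M (X 1)" unfolding hyperbolic_secant_dist_def by blast
  next
    assume "hyperbolic_secant_dist M (X 1)"
    then obtain a where a: "a > 0"
      and dist: "distributed M lborel (X 1) (\<lambda>x. ennreal (hyperbolic_secant_density a x))"
      unfolding hyperbolic_secant_dist_def by blast
    have "?\<mu> = distr M lborel (X 1)" by (intro distr_cong) simp_all
    also have "\<dots> = hyperbolic_secant_measure a" by (rule distributed_distr_eq_density[OF dist])
    finally have char_X: "char ?\<mu> t = of_real (1 / cosh (pi * a * t / 2))" for t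
      using char_hyperbolic_secant[OF a] by simp
    have "char ?\<mu> t = char (distr M borel ?Y) t" for t
    proof -
      have "1 / cosh (pi * a * t / 2) = (1 / cosh (pi * a * (t / 2) / 2))\<^sup>2 * (1 + 1 / cosh (pi * a * t / 2)) / 2"
        using sech_halving[of "pi * a * (t / 2) / 2"] by (simp add: mult.assoc)
      then have "complex_of_real (1 / cosh (pi * a * t / 2))
          = of_real ((1 / cosh (pi * a * (t / 2) / 2))\<^sup>2 * (1 + 1 / cosh (pi * a * t / 2)) / 2)"
        by (simp only: of_real_eq_iff)
      then show ?thesis unfolding char_Y char_X by simp
    qed
    then show "eq_in_dist M (X 1) ?Y"
      unfolding eq_in_dist_def by (intro Levy_uniqueness real real_Y ext)
  qed
qed

end
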